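(* Let $M$ be a matroid that has a tensor product with the uniform matroid $U_{2,3}$. Then $M$ is $1$-modular extendable.
   Context: "Matroid" means a matroid on a finite ground set, written as (ground set, rank function). $U_{2,3}$ is the rank-$2$ uniform matroid on three elements. A matroid $N=(S_1\times S_2,r)$ is a tensor product of $M_1=(S_1,r_1)$ and $M_2=(S_2,r_2)$ if $r(X\times Y)=r_1(X)\cdot r_2(Y)$ for all $X\subseteq S_1$, $Y\subseteq S_2$. A matroid $M=(S,r)$ is $1$-modular extendable if for all $A,B\subseteq S$ there is a matroid $M'=(S',r')$ with $S\subseteq S'$, $r'(X)=r(X)$ for all $X\subseteq S$, and a set $Z\subseteq S'$ with $r'(A\cup Z)=r(A)$, $r'(B\cup Z)=r(B)$ and $r'(Z)=r(A)+r(B)-r(A\cup B)$. *)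

theory Defs
  imports Main
begin

text \<open>
  A finite matroid is given by its ground set and its rank function. Only the values of the rank
  function on subsets of the ground set are constrained.
\<close>

locale matroid =
  fixes S :: "'a set" and r :: "'a set \<Rightarrow> nat"
  assumes finite_ground: "finite S"
    and rank_le_card: "X \<subseteq> S \<Longrightarrow> r X \<le> card X"
    and rank_mono: "X \<subseteq> Y \<Longrightarrow> Y \<subseteq> S \<Longrightarrow> r X \<le> r Y"
    and rank_submodular:
      "X \<subseteq> S \<Longrightarrow> Y \<subseteq> S \<Longrightarrow> r (X \<union> Y) + r (X \<inter> Y) \<le> r X + r Y"

definition uniform_rank :: "nat \<Rightarrow> 'a set \<Rightarrow> nat" where
  "uniform_rank k X = min k (card X)"

abbreviation U23_ground :: "nat set" where
  "U23_ground \<equiv> {0, 1, 2}"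

abbreviation U23_rank :: "nat set \<Rightarrow> nat" where
  "U23_rank \<equiv> uniform_rank 2"

definition is_tensor_product ::
  "'a set \<Rightarrow> ('a set \<Rightarrow> nat) \<Rightarrow> 'b set \<Rightarrow> ('b set \<Rightarrow> nat) \<Rightarrow> (('a \<times> 'b) set \<Rightarrow> nat) \<Rightarrow> bool" where
  "is_tensor_product S\<^sub>1 r\<^sub>1 S\<^sub>2 r\<^sub>2 r \<longleftrightarrow>
     matroid (S\<^sub>1 \<times> S\<^sub>2) r \<and>
     (\<forall>X Y. X \<subseteq> S\<^sub>1 \<longrightarrow> Y \<subseteq> S\<^sub>2 \<longrightarrow> r (X \<times> Y) = r\<^sub>1 X * r\<^sub>2 Y)"

definition has_tensor_product ::
  "'a set \<Rightarrow> ('a set \<Rightarrow> nat) \<Rightarrow> 'b set \<Rightarrow> ('b set \<Rightarrow> nat) \<Rightarrow> bool" where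
  "has_tensor_product S\<^sub>1 r\<^sub>1 S\<^sub>2 r\<^sub>2 \<longleftrightarrow> (\<exists>r. is_tensor_product S\<^sub>1 r\<^sub>1 S\<^sub>2 r\<^sub>2 r)"

text \<open>
  The type of the elements of a matroid may have too few elements to accommodate an extension.
  The ground set of an extension is therefore taken in \<open>'a + nat\<close>, with \<open>Inl\<close> as the inclusion of
  the old elements. As ground sets are finite, this loses no extension: see
  \<open>one_modular_extendableI\<close> below.
\<close>

definition one_modular_extendable :: "'a set \<Rightarrow> ('a set \<Rightarrow> nat) \<Rightarrow> bool" where
  "one_modular_extendable S r \<longleftrightarrow>
     (\<forall>A B. A \<subseteq> S \<longrightarrow> B \<subseteq> S \<longrightarrow>
       (\<exists>(S' :: ('a + nat) set) r'. matroid S' r' \<and> Inl ` S \<subseteq> S' \<and>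
          (\<forall>X. X \<subseteq> S \<longrightarrow> r' (Inl ` X) = r X) \<and>
          (\<exists>Z. Z \<subseteq> S' \<and> r' (Inl ` A \<union> Z) = r A \<and> r' (Inl ` B \<union> Z) = r B \<and>
             int (r' Z) = int (r A) + int (r B) - int (r (A \<union> B)))))"

lemma matroid_uniform:
  assumes "finite S"
  shows "matroid S (uniform_rank k)"
proof
  fix X Y assume X: "X \<subseteq> S" and Y: "Y \<subseteq> S"
  then have fin: "finite X" "finite Y" using assms by (auto dest: finite_subset)
  have "card (X \<union> Y) + card (X \<inter> Y) = card X + card Y"
    using card_Un_Int[OF fin] by simp
  moreover have "card X \<le> card (X \<union> Y)" "card Y \<le> card (X \<union> Y)"
    "card (X \<inter> Y) \<le> card X" "card (X \<inter> Y) \<le> card Y"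
    using fin by (auto intro: card_mono)
  ultimately show "uniform_rank k (X \<union> Y) + uniform_rank k (X \<inter> Y)
      \<le> uniform_rank k X + uniform_rank k Y"
    unfolding uniform_rank_def by linarith
next
  fix X Y assume "X \<subseteq> Y" "Y \<subseteq> S"
  then have "card X \<le> card Y" using assms by (meson card_mono finite_subset)
  then show "uniform_rank k X \<le> uniform_rank k Y" unfolding uniform_rank_def by linarith
qed (use assms in \<open>auto simp: uniform_rank_def\<close>)

lemma matroid_inj_image:
  fixes g :: "'a \<Rightarrow> 'b"
  assumes "matroid S r" and inj: "inj_on g S"
  shows "matroid (g ` S) (\<lambda>X. r {x \<in> S. g x \<in> X})"
proof -
  interpret matroid S r by fact
  show ?thesis
  proof
    show "finite (g ` S)" using finite_ground by simp
  next
    fix X assume X: "X \<subseteq> g ` S"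
    have "g ` {x \<in> S. g x \<in> X} = X" using X by auto
    moreover have "inj_on g {x \<in> S. g x \<in> X}" using inj by (rule inj_on_subset) auto
    ultimately have "card {x \<in> S. g x \<in> X} = card X" by (metis card_image)
    then show "r {x \<in> S. g x \<in> X} \<le> card X"
      using rank_le_card[of "{x \<in> S. g x \<in> X}"] by auto
  next
    fix X Y :: "'b set" assume "X \<subseteq> Y"
    then show "r {x \<in> S. g x \<in> X} \<le> r {x \<in> S. g x \<in> Y}"
      by (intro rank_mono) auto
  next
    fix X Y :: "'b set"
    have "{x \<in> S. g x \<in> X \<union> Y} = {x \<in> S. g x \<in> X} \<union> {x \<in> S. g x \<in> Y}"
      "{x \<in> S. g x \<in> X \<inter> Y} = {x \<in> S. g x \<in> X} \<inter> {x \<in> S. g x \<in> Y}" by auto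
    then show "r {x \<in> S. g x \<in> X \<union> Y} + r {x \<in> S. g x \<in> X \<inter> Y}
        \<le> r {x \<in> S. g x \<in> X} + r {x \<in> S. g x \<in> Y}"
      using rank_submodular[of "{x \<in> S. g x \<in> X}" "{x \<in> S. g x \<in> Y}"] by auto
  qed
qed

lemma one_modular_extendableI:
  fixes f :: "'a \<Rightarrow> 'c"
  assumes inj: "inj_on f S"
    and ext: "\<And>A B. A \<subseteq> S \<Longrightarrow> B \<subseteq> S \<Longrightarrow>
       \<exists>(T :: 'c set) t Z. matroid T t \<and> f ` S \<subseteq> T \<and> (\<forall>X. X \<subseteq> S \<longrightarrow> t (f ` X) = r X) \<and>
         Z \<subseteq> T \<and> t (f ` A \<union> Z) = r A \<and> t (f ` B \<union> Z) = r B \<and>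
         int (t Z) = int (r A) + int (r B) - int (r (A \<union> B))"
  shows "one_modular_extendable S r"
  unfolding one_modular_extendable_def
proof (intro allI impI)
  fix A B assume A: "A \<subseteq> S" and B: "B \<subseteq> S"
  obtain T :: "'c set" and t Z where T: "matroid T t" "f ` S \<subseteq> T"
      and t: "\<And>X. X \<subseteq> S \<Longrightarrow> t (f ` X) = r X"
      and Z: "Z \<subseteq> T" "t (f ` A \<union> Z) = r A" "t (f ` B \<union> Z) = r B"
        "int (t Z) = int (r A) + int (r B) - int (r (A \<union> B))"
    using ext[OF A B] by auto
  obtain h :: "'c \<Rightarrow> nat" where h: "inj_on h T"
    using finite_imp_inj_to_nat_seg[OF matroid.finite_ground[OF T(1)]] by auto
  define g :: "'c \<Rightarrow> 'a + nat" where
    "g y = (if y \<in> f ` S then Inl (the_inv_into S f y) else Inr (h y))" for y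
  have gf: "g (f x) = Inl x" if "x \<in> S" for x
    using that by (simp add: g_def the_inv_into_f_f[OF inj])
  have g: "inj_on g T"
  proof (rule inj_onI)
    fix y z assume yz: "y \<in> T" "z \<in> T" "g y = g z"
    show "y = z"
    proof (cases "y \<in> f ` S")
      case True
      then have "z \<in> f ` S" using yz(3) by (auto simp: g_def split: if_splits)
      with True yz(3) show ?thesis by (auto simp: gf)
    next
      case False
      then have "z \<notin> f ` S" using yz(3) by (auto simp: g_def split: if_splits)
      with False yz h show ?thesis by (auto simp: g_def dest: inj_onD)
    qed
  qed
  define t' where "t' X = t {y \<in> T. g y \<in> X}" for X
  have t'g: "t' (g ` Y) = t Y" if "Y \<subseteq> T" for Y
  proof -
    have "{y \<in> T. g y \<in> g ` Y} = Y" using that g by (auto simp: inj_on_def)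
    then show ?thesis by (simp add: t'_def)
  qed
  have img: "Inl ` X = g ` f ` X" if "X \<subseteq> S" for X
    using that gf by (force simp: image_image)
  have sub: "f ` X \<subseteq> T" if "X \<subseteq> S" for X using that T(2) by auto
  show "\<exists>(S' :: ('a + nat) set) r'. matroid S' r' \<and> Inl ` S \<subseteq> S' \<and>
          (\<forall>X. X \<subseteq> S \<longrightarrow> r' (Inl ` X) = r X) \<and>
          (\<exists>Z. Z \<subseteq> S' \<and> r' (Inl ` A \<union> Z) = r A \<and> r' (Inl ` B \<union> Z) = r B \<and>
             int (r' Z) = int (r A) + int (r B) - int (r (A \<union> B)))"
  proof (intro exI conjI allI impI)
    show "matroid (g ` T) t'"
      using matroid_inj_image[OF T(1) g] by (simp add: t'_def[abs_def])
    show "Inl ` S \<subseteq> g ` T" using T(2) by (simp add: img image_mono)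
    show "t' (Inl ` X) = r X" if "X \<subseteq> S" for X
      using that by (simp add: img t'g sub t)
    show "g ` Z \<subseteq> g ` T" using Z(1) by auto
    show "t' (Inl ` A \<union> g ` Z) = r A"
      using t'g[of "f ` A \<union> Z"] sub[OF A] Z by (simp add: img[OF A] image_Un)
    show "t' (Inl ` B \<union> g ` Z) = r B"
      using t'g[of "f ` B \<union> Z"] sub[OF B] Z by (simp add: img[OF B] image_Un)
    show "int (t' (g ` Z)) = int (r A) + int (r B) - int (r (A \<union> B))"
      using Z by (simp add: t'g)
  qed
qed

end

theory Submission
  imports Defs
begin

text \<open>
  Think of a tensor product with \<open>U\<^sub>2\<^sub>,\<^sub>3\<close> as three copies ("columns") of \<open>M\<close>, made of the vectors
  \<open>x \<otimes> e\<close>, \<open>x \<otimes> f\<close> and \<open>x \<otimes> (e + f)\<close>. If \<open>M\<close> is represented in a vector space \<open>V\<close>, then contracting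
  \<open>A \<otimes> e\<close> and \<open>B \<otimes> f\<close> sends \<open>x \<otimes> (e + f)\<close> to the class of \<open>x\<close> in both \<open>V / \<langle>A\<rangle>\<close> and \<open>V / \<langle>B\<rangle>\<close>,
  whose kernel is the intersection of \<open>\<langle>A\<rangle>\<close> and \<open>\<langle>B\<rangle>\<close>. So what this contraction leaves on the third
  column should be \<open>M' / Z\<close> for the extension \<open>M'\<close> and the set \<open>Z\<close> that are wanted.

  This recovers \<open>M'\<close> without any representation. The contraction, called \<open>q\<close>, is a quotient of \<open>M\<close>
  (\<open>matroid_quotient_contraction\<close>). In the tensor product any two columns are skew, and any two
  columns of a set span the third; hence the rank of \<open>X\<close> in column three together with \<open>A\<close> in column
  one and \<open>B\<close> in column two is \<open>r X + r (A \<union> B)\<close> whenever \<open>X\<close> contains \<open>A\<close> or \<open>B\<close>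
  (\<open>tensor_U23_rank_three_columns\<close>). With \<open>k = r A + r B - r (A \<union> B)\<close> this says that \<open>q\<close> is lower
  than \<open>r\<close> by exactly \<open>k\<close> at each of \<open>A\<close>, \<open>B\<close> and \<open>S\<close>. Finally, Higgs's factorization
  (\<open>quotient_extension\<close>) realizes a quotient of rank defect \<open>k\<close> as the contraction of a set \<open>Z\<close> of
  \<open>k\<close> new elements that are independent in an extension of \<open>M\<close>, so that \<open>A \<union> Z\<close> has rank
  \<open>q A + k = r A\<close>, and similarly for \<open>B\<close>.
\<close>

section \<open>Skew sets and spanned sets\<close>

context matroid
begin

lemma rank_empty: "r {} = 0"
  using rank_le_card[of "{}"] by simp

lemma rank_Un_le: "X \<subseteq> S \<Longrightarrow> Y \<subseteq> S \<Longrightarrow> r (X \<union> Y) \<le> r X + r Y"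
  using rank_submodular[of X Y] by simp

text \<open>
  By submodularity, the gain in rank from adding a set can only decrease when the set that it is
  added to grows.
\<close>

lemma rank_Un_spanned:
  assumes "X \<subseteq> X'" "X' \<subseteq> S" "Y \<subseteq> S" and "r (X \<union> Y) = r X"
  shows "r (X' \<union> Y) = r X'"
proof -
  have "r (X' \<union> (X \<union> Y)) + r (X' \<inter> (X \<union> Y)) \<le> r X' + r (X \<union> Y)"
    by (rule rank_submodular) (use assms in auto)
  moreover have "X' \<union> (X \<union> Y) = X' \<union> Y" using assms by auto
  moreover have "r X \<le> r (X' \<inter> (X \<union> Y))" "r X' \<le> r (X' \<union> Y)"
    using assms by (auto intro!: rank_mono)
  ultimately show ?thesis using assms by simp
qed

text \<open>
  Shrinking one of two skew sets lowers the rank of their union by no more than it lowers the rank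
  of that set, again by submodularity; so the two sets can be shrunk one after the other.
\<close>

lemma rank_Un_skew_subsets:
  assumes "P \<subseteq> S" "Q \<subseteq> S" and skew: "r (P \<union> Q) = r P + r Q"
    and "P' \<subseteq> P" "Q' \<subseteq> Q"
  shows "r (P' \<union> Q') = r P' + r Q'"
proof -
  have shrink: "r (P \<union> Q') = r P + r Q'"
    if "P \<subseteq> S" "Q \<subseteq> S" "r (P \<union> Q) = r P + r Q" "Q' \<subseteq> Q" for P Q Q'
  proof -
    have "r ((P \<union> Q') \<union> Q) + r ((P \<union> Q') \<inter> Q) \<le> r (P \<union> Q') + r Q"
      by (rule rank_submodular) (use that in auto)
    moreover have "(P \<union> Q') \<union> Q = P \<union> Q" using that by auto
    moreover have "r Q' \<le> r ((P \<union> Q') \<inter> Q)" using that by (auto intro!: rank_mono)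
    moreover have "r (P \<union> Q') \<le> r P + r Q'" using that by (intro rank_Un_le) auto
    ultimately show ?thesis using that by simp
  qed
  have "r (Q' \<union> P) = r Q' + r P"
    using shrink[OF \<open>P \<subseteq> S\<close> \<open>Q \<subseteq> S\<close> skew \<open>Q' \<subseteq> Q\<close>] by (simp add: Un_commute add.commute)
  then have "r (Q' \<union> P') = r Q' + r P'"
    by (rule shrink[rotated 2]) (use assms in auto)
  then show ?thesis by (simp add: Un_commute add.commute)
qed

end

section \<open>Quotients and their realization by extensions\<close>

text \<open>
  The last axiom is the rank form of the statement that every flat of the quotient is a flat of the
  matroid: \<open>r - q\<close> is monotone.
\<close>

locale matroid_quotient = matroid S r for S :: "'a set" and r +
  fixes q :: "'a set \<Rightarrow> nat"
  assumes quot_empty: "q {} = 0"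
    and quot_mono: "X \<subseteq> Y \<Longrightarrow> Y \<subseteq> S \<Longrightarrow> q X \<le> q Y"
    and quot_submodular:
      "X \<subseteq> S \<Longrightarrow> Y \<subseteq> S \<Longrightarrow> q (X \<union> Y) + q (X \<inter> Y) \<le> q X + q Y"
    and quot_defect_mono: "X \<subseteq> Y \<Longrightarrow> Y \<subseteq> S \<Longrightarrow> r X + q Y \<le> r Y + q X"
begin

lemma quot_le_rank: "X \<subseteq> S \<Longrightarrow> q X \<le> r X"
  using quot_defect_mono[of "{}" X] by (simp add: rank_empty quot_empty)

text \<open>
  The Higgs lifts of a quotient. If at \<open>X\<close> and \<open>Y\<close> the minimum is attained by the same function,
  submodularity is that of \<open>r\<close> or \<open>q\<close>; if it is \<open>r\<close> at \<open>X\<close> and \<open>q + j\<close> at \<open>Y\<close>, estimate the union by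
  \<open>q + j\<close> and the intersection by \<open>r\<close>, and use that \<open>r - q\<close> does not decrease from \<open>X \<inter> Y\<close> to \<open>X\<close>.
\<close>

lemma matroid_Higgs_lift: "matroid S (\<lambda>X. min (r X) (q X + j))"
proof
  show "finite S" by (rule finite_ground)
next
  fix X assume "X \<subseteq> S"
  then show "min (r X) (q X + j) \<le> card X" using rank_le_card[of X] by simp
next
  fix X Y assume "X \<subseteq> Y" "Y \<subseteq> S"
  then show "min (r X) (q X + j) \<le> min (r Y) (q Y + j)"
    using rank_mono[of X Y] quot_mono[of X Y] by linarith
next
  fix X Y assume X: "X \<subseteq> S" and Y: "Y \<subseteq> S"
  have "r (X \<inter> Y) + q X \<le> r X + q (X \<inter> Y)" "r (X \<inter> Y) + q Y \<le> r Y + q (X \<inter> Y)"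
    using X Y by (auto intro!: quot_defect_mono)
  with rank_submodular[OF X Y] quot_submodular[OF X Y]
  show "min (r (X \<union> Y)) (q (X \<union> Y) + j) + min (r (X \<inter> Y)) (q (X \<inter> Y) + j)
      \<le> min (r X) (q X + j) + min (r Y) (q Y + j)"
    by linarith
qed

end

lemma matroid_quotient_add_free_loops:
  fixes F :: "'b set"
  assumes "matroid_quotient S r q" and "finite F"
  shows "matroid_quotient (S <+> F) (\<lambda>X. r (Inl -` X) + card (Inr -` X)) (\<lambda>X. q (Inl -` X))"
proof -
  interpret matroid_quotient S r q by fact
  have sub: "Inl -` X \<subseteq> S" "Inr -` X \<subseteq> F" "finite (Inr -` X)" if "X \<subseteq> S <+> F" for X :: "('a + 'b) set"
    using that \<open>finite F\<close> by (auto intro: finite_subset[of _ F])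
  show ?thesis
  proof
    show "finite (S <+> F)" using finite_ground \<open>finite F\<close> by simp
  next
    fix X :: "('a + 'b) set" assume X: "X \<subseteq> S <+> F"
    have "Inl -` X <+> Inr -` X = X"
    proof (rule set_eqI)
      show "x \<in> Inl -` X <+> Inr -` X \<longleftrightarrow> x \<in> X" for x by (cases x) auto
    qed
    then have "card X = card (Inl -` X) + card (Inr -` X)"
      using card_Plus[of "Inl -` X" "Inr -` X"] sub[OF X] finite_ground finite_subset by metis
    then show "r (Inl -` X) + card (Inr -` X) \<le> card X"
      using rank_le_card[OF sub(1)[OF X]] by simp
  next
    fix X Y :: "('a + 'b) set" assume XY: "X \<subseteq> Y" and Y: "Y \<subseteq> S <+> F"
    then have v: "Inl -` X \<subseteq> Inl -` Y" "Inr -` X \<subseteq> Inr -` Y" by auto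
    have c: "card (Inr -` X) \<le> card (Inr -` Y)" using v sub[OF Y] by (intro card_mono)
    then show "r (Inl -` X) + card (Inr -` X) \<le> r (Inl -` Y) + card (Inr -` Y)"
      using rank_mono[OF v(1) sub(1)[OF Y]] by simp
    show "q (Inl -` X) \<le> q (Inl -` Y)" using quot_mono[OF v(1) sub(1)[OF Y]] .
    show "r (Inl -` X) + card (Inr -` X) + q (Inl -` Y)
        \<le> r (Inl -` Y) + card (Inr -` Y) + q (Inl -` X)"
      using quot_defect_mono[OF v(1) sub(1)[OF Y]] c by simp
  next
    fix X Y :: "('a + 'b) set" assume X: "X \<subseteq> S <+> F" and Y: "Y \<subseteq> S <+> F"
    show "r (Inl -` (X \<union> Y)) + card (Inr -` (X \<union> Y)) + (r (Inl -` (X \<inter> Y)) + card (Inr -` (X \<inter> Y)))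
        \<le> r (Inl -` X) + card (Inr -` X) + (r (Inl -` Y) + card (Inr -` Y))"
      using rank_submodular[OF sub(1)[OF X] sub(1)[OF Y]]
        card_Un_Int[OF sub(3)[OF X] sub(3)[OF Y]] by simp
    show "q (Inl -` (X \<union> Y)) + q (Inl -` (X \<inter> Y)) \<le> q (Inl -` X) + q (Inl -` Y)"
      using quot_submodular[OF sub(1)[OF X] sub(1)[OF Y]] by simp
  qed (simp add: quot_empty)
qed

text \<open>
  Higgs's factorization: make the new elements free in the matroid and loops in the quotient, and
  take the lift of order \<open>card F\<close>. The rank of \<open>X\<close> stays \<open>r X\<close> because \<open>r - q\<close> is at most its
  value at \<open>S\<close>, hence at most \<open>card F\<close>. With all new elements added, the minimum is attained by the
  other function, because \<open>q X \<le> r X\<close>.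
\<close>

lemma quotient_extension:
  fixes F :: "'b set"
  assumes "matroid_quotient S r q" and "finite F" and defect: "r S \<le> q S + card F"
  obtains r' where "matroid (S <+> F) r'"
    and "\<And>X. X \<subseteq> S \<Longrightarrow> r' (Inl ` X) = r X"
    and "\<And>X. X \<subseteq> S \<Longrightarrow> r' (Inl ` X \<union> Inr ` F) = q X + card F"
proof -
  interpret matroid_quotient S r q by fact
  define r' where
    "r' X = min (r (Inl -` X) + card (Inr -` X)) (q (Inl -` X) + card F)" for X :: "('a + 'b) set"
  have v: "Inl -` (Inl ` X) = X" "Inr -` (Inl ` X) = ({} :: 'b set)"
    "Inl -` (Inr ` F) = ({} :: 'a set)" "Inr -` (Inr ` F) = F" for X :: "'a set"
    by auto
  show ?thesis
  proof (rule that[of r'])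
    show "matroid (S <+> F) r'"
      using matroid_quotient.matroid_Higgs_lift[OF
          matroid_quotient_add_free_loops[OF assms(1,2)], of "card F"]
      by (simp add: r'_def[abs_def])
  next
    fix X assume X: "X \<subseteq> S"
    have "r X + q S \<le> r S + q X" using X by (intro quot_defect_mono) auto
    with defect show "r' (Inl ` X) = r X" by (simp add: r'_def v)
    show "r' (Inl ` X \<union> Inr ` F) = q X + card F"
      using quot_le_rank[OF X] by (simp add: r'_def v)
  qed
qed

text \<open>
  The basic source of quotients: contract a set \<open>C\<close> in a matroid in which \<open>f\<close> embeds \<open>(S, r)\<close>.
  That the defect \<open>r - q\<close> grows with \<open>X\<close> is submodularity for \<open>f ` Y\<close> and \<open>f ` X \<union> C\<close>.
\<close>

lemma matroid_quotient_contraction: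
  fixes f :: "'a \<Rightarrow> 'e"
  assumes "matroid S r" and "matroid E R" and f: "f ` S \<subseteq> E"
    and R: "\<And>X. X \<subseteq> S \<Longrightarrow> R (f ` X) = r X" and C: "C \<subseteq> E"
  shows "matroid_quotient S r (\<lambda>X. R (f ` X \<union> C) - R C)"
proof -
  interpret M: matroid S r by fact
  interpret N: matroid E R by fact
  have E: "f ` X \<union> C \<subseteq> E" if "X \<subseteq> S" for X using that f C by auto
  have ge: "R C \<le> R (f ` X \<union> C)" if "X \<subseteq> S" for X
    using E[OF that] by (intro N.rank_mono) auto
  show ?thesis
  proof
    fix X Y assume XY: "X \<subseteq> Y" and Y: "Y \<subseteq> S"
    then have X: "X \<subseteq> S" by auto
    have "R (f ` X \<union> C) \<le> R (f ` Y \<union> C)" using E[OF Y] XY by (intro N.rank_mono) auto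
    then show "R (f ` X \<union> C) - R C \<le> R (f ` Y \<union> C) - R C" by simp
    have "R (f ` Y \<union> (f ` X \<union> C)) + R (f ` Y \<inter> (f ` X \<union> C)) \<le> R (f ` Y) + R (f ` X \<union> C)"
      using E[OF X] E[OF Y] by (intro N.rank_submodular) auto
    moreover have "f ` Y \<union> (f ` X \<union> C) = f ` Y \<union> C" using XY by auto
    moreover have "R (f ` X) \<le> R (f ` Y \<inter> (f ` X \<union> C))"
      using E[OF Y] XY by (intro N.rank_mono) auto
    ultimately show "r X + (R (f ` Y \<union> C) - R C) \<le> r Y + (R (f ` X \<union> C) - R C)"
      using ge[OF X] ge[OF Y] R[OF X] R[OF Y] by simp
  next
    fix X Y assume X: "X \<subseteq> S" and Y: "Y \<subseteq> S"
    then have I: "X \<inter> Y \<subseteq> S" and U: "X \<union> Y \<subseteq> S" by auto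
    have "R ((f ` X \<union> C) \<union> (f ` Y \<union> C)) + R ((f ` X \<union> C) \<inter> (f ` Y \<union> C))
        \<le> R (f ` X \<union> C) + R (f ` Y \<union> C)"
      using E[OF X] E[OF Y] by (rule N.rank_submodular)
    moreover have "(f ` X \<union> C) \<union> (f ` Y \<union> C) = f ` (X \<union> Y) \<union> C" by (auto simp: image_Un)
    moreover have "R (f ` (X \<inter> Y) \<union> C) \<le> R ((f ` X \<union> C) \<inter> (f ` Y \<union> C))"
      using E[OF X] by (intro N.rank_mono) auto
    ultimately show "R (f ` (X \<union> Y) \<union> C) - R C + (R (f ` (X \<inter> Y) \<union> C) - R C)
        \<le> R (f ` X \<union> C) - R C + (R (f ` Y \<union> C) - R C)"
      using ge[OF X] ge[OF Y] ge[OF I] ge[OF U] by simp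
  qed simp
qed

section \<open>Tensor products with the uniform matroid of rank two on three elements\<close>

text \<open>
  Two full columns have rank \<open>2 * r S\<close>, so they are skew, and skewness passes to subsets.
\<close>

lemma tensor_U23_rank_two_columns:
  assumes "is_tensor_product S r U23_ground U23_rank R"
    and "X \<subseteq> S" "Y \<subseteq> S" and ij: "i \<in> U23_ground" "j \<in> U23_ground" "i \<noteq> j"
  shows "R (X \<times> {i} \<union> Y \<times> {j}) = r X + r Y"
proof -
  interpret N: matroid "S \<times> U23_ground" R
    using assms(1) by (simp add: is_tensor_product_def)
  have R: "R (X \<times> I) = r X * U23_rank I" if "X \<subseteq> S" "I \<subseteq> U23_ground" for X I
    using assms(1) that unfolding is_tensor_product_def by blast
  have single: "R (X \<times> {l}) = r X" if "X \<subseteq> S" "l \<in> U23_ground" for X l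
    using that by (subst R) (auto simp: uniform_rank_def)
  have sub: "S \<times> {i} \<subseteq> S \<times> U23_ground" "S \<times> {j} \<subseteq> S \<times> U23_ground"
    using ij(1,2) by (simp_all add: Sigma_mono del: insert_iff)
  have "S \<times> {i} \<union> S \<times> {j} = S \<times> {i, j}" by auto
  moreover have "R (S \<times> {i, j}) = r S * U23_rank {i, j}"
    using ij(1,2) by (intro R) (simp_all del: insert_iff)
  moreover have "U23_rank {i, j} = 2" using ij(3) by (simp add: uniform_rank_def)
  ultimately have "R (S \<times> {i} \<union> S \<times> {j}) = R (S \<times> {i}) + R (S \<times> {j})"
    using single[OF subset_refl ij(1)] single[OF subset_refl ij(2)] by (simp only: mult_2_right)
  then have "R (X \<times> {i} \<union> Y \<times> {j}) = R (X \<times> {i}) + R (Y \<times> {j})"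
    by (rule N.rank_Un_skew_subsets[OF sub]) (use assms(2,3) in blast)+
  then show ?thesis
    using single[OF assms(2) ij(1)] single[OF assms(3) ij(2)] by simp
qed

text \<open>
  Both \<open>U\<^sub>2\<^sub>,\<^sub>3\<close> and each of its two-element subsets have rank two, so two columns of \<open>A\<close> already have
  the rank \<open>2 * r A\<close> of all three.
\<close>

lemma tensor_U23_third_column_spanned:
  assumes "is_tensor_product S r U23_ground U23_rank R"
    and A: "A \<subseteq> S" and cols: "U23_ground = {i, j, l}" and "i \<noteq> j"
    and W: "A \<times> {i} \<union> A \<times> {j} \<subseteq> W" "W \<subseteq> S \<times> U23_ground"
  shows "R (W \<union> A \<times> {l}) = R W"
proof -
  interpret N: matroid "S \<times> U23_ground" R
    using assms(1) by (simp add: is_tensor_product_def)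
  have "R (A \<times> U23_ground) = r A * U23_rank U23_ground"
    using assms(1) A unfolding is_tensor_product_def by blast
  moreover have "A \<times> U23_ground = A \<times> {i} \<union> A \<times> {j} \<union> A \<times> {l}"
    unfolding cols by auto
  moreover have "U23_rank U23_ground = 2" by (simp add: uniform_rank_def)
  moreover have "i \<in> U23_ground" "j \<in> U23_ground"
    unfolding cols by simp_all
  then have "R (A \<times> {i} \<union> A \<times> {j}) = r A + r A"
    by (rule tensor_U23_rank_two_columns[OF assms(1) A A _ _ \<open>i \<noteq> j\<close>])
  ultimately have "R (A \<times> {i} \<union> A \<times> {j} \<union> A \<times> {l}) = R (A \<times> {i} \<union> A \<times> {j})" by simp
  moreover have "A \<times> {l} \<subseteq> S \<times> U23_ground"
    using A unfolding cols by auto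
  ultimately show ?thesis by (intro N.rank_Un_spanned[OF W])
qed

text \<open>
  Columns \<open>l\<close> and \<open>i\<close> of \<open>A\<close> span column \<open>j\<close> of \<open>A\<close>, which can thus be added at no cost. But then
  columns \<open>l\<close> and \<open>j\<close> of \<open>A\<close> span column \<open>i\<close>, which can be dropped, and two columns remain.
\<close>

lemma tensor_U23_rank_three_columns:
  assumes T: "is_tensor_product S r U23_ground U23_rank R"
    and sub: "A \<subseteq> X" "X \<subseteq> S" "B \<subseteq> S"
    and cols: "U23_ground = {i, j, l}" "distinct [i, j, l]"
  shows "R (X \<times> {l} \<union> (A \<times> {i} \<union> B \<times> {j})) = r X + r (A \<union> B)"
proof -
  let ?W = "X \<times> {l} \<union> (A \<times> {i} \<union> B \<times> {j})" and ?V = "X \<times> {l} \<union> (A \<union> B) \<times> {j}"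
  have perm: "U23_ground = {l, i, j}" "U23_ground = {l, j, i}" unfolding cols(1) by auto
  have A: "A \<subseteq> S" and l: "l \<noteq> i" "l \<noteq> j" using sub cols(2) by auto
  have mem: "l \<in> U23_ground" "j \<in> U23_ground" unfolding cols(1) by simp_all
  have "A \<times> {l} \<union> A \<times> {i} \<subseteq> ?W" using sub by auto
  moreover have "?W \<subseteq> S \<times> U23_ground" using sub unfolding cols(1) by auto
  ultimately have W: "R (?W \<union> A \<times> {j}) = R ?W"
    by (rule tensor_U23_third_column_spanned[OF T A perm(1) l(1)])
  have "A \<times> {l} \<union> A \<times> {j} \<subseteq> ?V" using sub by auto
  moreover have "?V \<subseteq> S \<times> U23_ground" using sub unfolding cols(1) by auto
  ultimately have V: "R (?V \<union> A \<times> {i}) = R ?V"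
    by (rule tensor_U23_third_column_spanned[OF T A perm(2) l(2)])
  have "?W \<union> A \<times> {j} = ?V \<union> A \<times> {i}" by auto
  moreover have "R ?V = r X + r (A \<union> B)"
    by (rule tensor_U23_rank_two_columns[OF T _ _ mem l(2)]) (use sub in auto)
  ultimately show ?thesis using W V by metis
qed

theorem corollary5p4:
  fixes S :: "'a set" and r :: "'a set \<Rightarrow> nat"
  assumes "matroid S r"
    and "has_tensor_product S r U23_ground U23_rank"
  shows "one_modular_extendable S r"
proof (rule one_modular_extendableI[where f = "Inl :: 'a \<Rightarrow> 'a + nat"])
  show "inj_on (Inl :: 'a \<Rightarrow> 'a + nat) S" by simp
next
  fix A B assume A: "A \<subseteq> S" and B: "B \<subseteq> S"
  interpret matroid S r by fact
  obtain R where T: "is_tensor_product S r U23_ground U23_rank R"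
    using assms(2) unfolding has_tensor_product_def by blast
  define C :: "('a \<times> nat) set" where "C = A \<times> {0} \<union> B \<times> {1}"
  define q where "q X = R ((\<lambda>x. (x, 2)) ` X \<union> C) - R C" for X
  define k where "k = r A + r B - r (A \<union> B)"
  have k: "r (A \<union> B) + k = r A + r B" using rank_Un_le[OF A B] by (simp add: k_def)
  have column: "(\<lambda>x. (x, 2)) ` X = X \<times> {2::nat}" for X :: "'a set" by auto
  have RC: "R C = r A + r B"
    unfolding C_def by (rule tensor_U23_rank_two_columns[OF T A B]) auto
  have quotient: "matroid_quotient S r q"
    unfolding q_def[abs_def]
  proof (rule matroid_quotient_contraction[OF assms(1)])
    show "matroid (S \<times> U23_ground) R" using T by (simp add: is_tensor_product_def)
    show "R ((\<lambda>x. (x, 2)) ` X) = r X" if "X \<subseteq> S" for X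
      using tensor_U23_rank_two_columns[OF T that, of "{}" 2 0] by (simp add: column rank_empty)
  qed (use A B in \<open>auto simp: C_def\<close>)
  have q_eq: "q X + k = r X" if X: "X \<subseteq> S" and AB: "A \<subseteq> X \<or> B \<subseteq> X" for X
  proof -
    have "R (X \<times> {2} \<union> C) = r X + r (A \<union> B)"
    proof (cases "A \<subseteq> X")
      case True
      then show ?thesis
        unfolding C_def by (rule tensor_U23_rank_three_columns[OF T _ X B]) auto
    next
      case False
      have "R (X \<times> {2} \<union> (B \<times> {1} \<union> A \<times> {0})) = r X + r (B \<union> A)"
        by (rule tensor_U23_rank_three_columns[OF T _ X A]) (use False AB in auto)
      then show ?thesis by (simp add: C_def Un_commute)
    qed
    \<comment> \<open>This keeps the subtraction of natural numbers in \<open>q X\<close> from being truncated.\<close>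
    moreover have "R C \<le> R (X \<times> {2} \<union> C)"
      using T X A B unfolding is_tensor_product_def C_def
      by (intro matroid.rank_mono[of "S \<times> U23_ground"]) auto
    ultimately show ?thesis using RC k by (simp add: q_def column)
  qed
  have "r S \<le> q S + card {..<k}" using q_eq[of S] A by simp
  then obtain r' where r': "matroid (S <+> {..<k}) r'"
      "\<And>X. X \<subseteq> S \<Longrightarrow> r' (Inl ` X) = r X"
      "\<And>X. X \<subseteq> S \<Longrightarrow> r' (Inl ` X \<union> Inr ` {..<k}) = q X + card {..<k}"
    using quotient_extension[OF quotient finite_lessThan] by metis
  show "\<exists>(S' :: ('a + nat) set) t Z. matroid S' t \<and> Inl ` S \<subseteq> S' \<and>
      (\<forall>X. X \<subseteq> S \<longrightarrow> t (Inl ` X) = r X) \<and>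
      Z \<subseteq> S' \<and> t (Inl ` A \<union> Z) = r A \<and> t (Inl ` B \<union> Z) = r B \<and>
      int (t Z) = int (r A) + int (r B) - int (r (A \<union> B))"
  proof (intro exI conjI allI impI)
    show "matroid (S <+> {..<k}) r'" by fact
    show "r' (Inl ` X) = r X" if "X \<subseteq> S" for X using that by (rule r')
    show "Inl ` S \<subseteq> S <+> {..<k}" "Inr ` {..<k} \<subseteq> S <+> {..<k}" by auto
    show "r' (Inl ` A \<union> Inr ` {..<k}) = r A" using r'(3)[OF A] q_eq[OF A] by simp
    show "r' (Inl ` B \<union> Inr ` {..<k}) = r B" using r'(3)[OF B] q_eq[OF B] by simp
    have "r' (Inr ` {..<k}) = k"
      using r'(3)[of "{}"] matroid_quotient.quot_empty[OF quotient] by simp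
    then show "int (r' (Inr ` {..<k})) = int (r A) + int (r B) - int (r (A \<union> B))"
      using k by linarith
  qed
qed

end
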